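(* Let $n\ge 1$, let $\Omega$ be a finite subset of $\mathbb{Z}^n$, and let $\lambda_i$ be the $i$-th eigenvalue of the Dirichlet Laplacian on $\Omega$. Then for any $1\leq k\leq \sharp\Omega-1$, $$\sum_{i=1}^k(\lambda_{k+1}-\lambda_{i})^2(1-\lambda_i)\leq \frac{4}{n}\sum_{i=1}^k(\lambda_{k+1}-\lambda_i)\lambda_i.$$
   Context: $\mathbb{Z}^n$ denotes the integer lattice graph: vertex set $\mathbb{Z}^n$, with $x\sim y$ (neighbors) iff $\sum_{i=1}^n|x_i-y_i|=1$; every vertex has degree $d_x=2n$. The discrete Laplacian is $\Delta f(x)=\frac{1}{d_x}\sum_{y\sim x}f(y)-f(x)$ for $f:\mathbb{Z}^n\to\mathbb{R}$. For a finite subset $\Omega\subset\mathbb{Z}^n$ and $f:\Omega\to\mathbb{R}$, the Dirichlet Laplacian is $\Delta_\Omega f(x)=\Delta\widetilde f(x)$ for $x\in\Omega$, where $\widetilde f$ is the extension of $f$ by $0$ to $\mathbb{Z}^n$. It is self-adjoint on functions on $\Omega$ with inner product $\langle f,g\rangle=\sum_{x\in\Omega}f(x)g(x)d_x$. The eigenvalues of the Dirichlet Laplacian on $\Omega$ are the eigenvalues of $-\Delta_\Omega$, listed in non-decreasing order with multiplicity: $0<\lambda_1\le\lambda_2\le\cdots\le\lambda_N\le 2$, where $N=\sharp\Omega$ is the number of vertices of $\Omega$. *)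

theory Defs
  imports "HOL-Analysis.Analysis" "HOL-Library.Function_Algebras" "HOL-Library.Multiset"
begin

definition lattice_neighbours :: "int ^ 'n \<Rightarrow> (int ^ 'n) set" where
  "lattice_neighbours x = {y. (\<Sum>i\<in>UNIV. \<bar>x $ i - y $ i\<bar>) = 1}"

definition lattice_degree :: "int ^ 'n \<Rightarrow> nat" where
  "lattice_degree x = card (lattice_neighbours x)"

lemma lattice_neighbours_eq:
  fixes x :: "int ^ 'n"
  shows "lattice_neighbours x = (\<lambda>(i, s). x + axis i s) ` (UNIV \<times> {1, -1})"
proof (intro equalityI subsetI)
  fix y assume "y \<in> lattice_neighbours x"
  then have s: "(\<Sum>i\<in>UNIV. \<bar>x $ i - y $ i\<bar>) = 1"
    by (simp add: lattice_neighbours_def)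
  then obtain i where i: "x $ i \<noteq> y $ i"
    by (metis (mono_tags, lifting) abs_zero diff_self sum.neutral zero_neq_one)
  have split: "(\<Sum>j\<in>UNIV. \<bar>x $ j - y $ j\<bar>) = \<bar>x $ i - y $ i\<bar> + (\<Sum>j\<in>UNIV - {i}. \<bar>x $ j - y $ j\<bar>)"
    by (rule sum.remove) auto
  have nn: "(\<Sum>j\<in>UNIV - {i}. \<bar>x $ j - y $ j\<bar>) \<ge> 0" by (rule sum_nonneg) auto
  have "(\<Sum>j\<in>UNIV - {i}. \<bar>x $ j - y $ j\<bar>) = 0" and one: "\<bar>x $ i - y $ i\<bar> = 1"
    using s split nn i by linarith+
  then have "\<And>j. j \<noteq> i \<Longrightarrow> x $ j = y $ j"
    by (subst (asm) sum_nonneg_eq_0_iff) auto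
  then have "y = x + axis i (y $ i - x $ i)"
    by (auto simp: vec_eq_iff axis_def)
  moreover have "y $ i - x $ i \<in> {1, -1}" using one by auto
  ultimately show "y \<in> (\<lambda>(i, s). x + axis i s) ` (UNIV \<times> {1, -1})"
    by (metis (no_types, lifting) SigmaI UNIV_I case_prod_conv image_eqI)
next
  fix y assume "y \<in> (\<lambda>(i, s). x + axis i s) ` (UNIV \<times> {1, -1})"
  then obtain i s where y: "y = x + axis i s" and s: "s = 1 \<or> s = -1" by auto
  have "(\<Sum>j\<in>UNIV. \<bar>x $ j - y $ j\<bar>) = (\<Sum>j\<in>UNIV. if j = i then 1 else 0)"
    using s by (intro sum.cong) (auto simp: y axis_def)
  then show "y \<in> lattice_neighbours x" by (simp add: lattice_neighbours_def)
qed

lemma finite_lattice_neighbours: "finite (lattice_neighbours x)"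
  by (simp add: lattice_neighbours_eq)

lemma lattice_degree_eq: "lattice_degree (x :: int ^ 'n) = 2 * CARD('n)"
proof -
  have "inj_on (\<lambda>(i, s). x + axis i s) (UNIV \<times> {1, -1})"
    by (auto simp: inj_on_def axis_eq_axis)
  then show ?thesis
    unfolding lattice_degree_def lattice_neighbours_eq by (subst card_image) (auto simp: card_cartesian_product)
qed

definition laplacian :: "(int ^ 'n \<Rightarrow> real) \<Rightarrow> int ^ 'n \<Rightarrow> real" where
  "laplacian f x = 1 / real (lattice_degree x) * (\<Sum>y\<in>lattice_neighbours x. f y) - f x"

definition zero_extension :: "(int ^ 'n) set \<Rightarrow> (int ^ 'n \<Rightarrow> real) \<Rightarrow> int ^ 'n \<Rightarrow> real" where
  "zero_extension \<Omega> f = (\<lambda>x. if x \<in> \<Omega> then f x else 0)"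

text \<open>A function \<open>\<Omega> \<rightarrow> \<real>\<close> is represented by a total function whose values off \<open>\<Omega>\<close> are irrelevant
  to the operator; in the linear space of functions on \<open>\<Omega>\<close> they are fixed to be \<open>0\<close>, so that
  dimensions of subspaces are the intended ones.\<close>

definition functions_on :: "(int ^ 'n) set \<Rightarrow> (int ^ 'n \<Rightarrow> real) set" where
  "functions_on \<Omega> = {f. \<forall>x. x \<notin> \<Omega> \<longrightarrow> f x = 0}"

definition dirichlet_laplacian ::
  "(int ^ 'n) set \<Rightarrow> (int ^ 'n \<Rightarrow> real) \<Rightarrow> int ^ 'n \<Rightarrow> real" where
  "dirichlet_laplacian \<Omega> f = (\<lambda>x. if x \<in> \<Omega> then laplacian (zero_extension \<Omega> f) x else 0)"

global_interpretation real_fun: vector_space "\<lambda>(c::real) (f :: 'a \<Rightarrow> real) x. c * f x"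
  by unfold_locales (auto simp: fun_eq_iff algebra_simps)

definition dirichlet_eigenspace :: "(int ^ 'n) set \<Rightarrow> real \<Rightarrow> (int ^ 'n \<Rightarrow> real) set" where
  "dirichlet_eigenspace \<Omega> \<mu> =
     {f \<in> functions_on \<Omega>. \<forall>x\<in>\<Omega>. - dirichlet_laplacian \<Omega> f x = \<mu> * f x}"

definition is_dirichlet_eigenvalue :: "(int ^ 'n) set \<Rightarrow> real \<Rightarrow> bool" where
  "is_dirichlet_eigenvalue \<Omega> \<mu> \<longleftrightarrow> (\<exists>f \<in> dirichlet_eigenspace \<Omega> \<mu>. \<exists>x. f x \<noteq> 0)"

text \<open>Multiplicity is the dimension of the eigenspace; since \<open>-\<Delta>\<^sub>\<Omega>\<close> is self-adjoint, this agrees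
  with the algebraic multiplicity, and the multiset has \<open>card \<Omega>\<close> elements for finite \<open>\<Omega>\<close>.\<close>

definition dirichlet_spectrum :: "(int ^ 'n) set \<Rightarrow> real multiset" where
  "dirichlet_spectrum \<Omega> =
     (\<Sum>\<mu> | is_dirichlet_eigenvalue \<Omega> \<mu>.
        replicate_mset (real_fun.dim (dirichlet_eigenspace \<Omega> \<mu>)) \<mu>)"

text \<open>Eigenvalues are numbered from 1 in non-decreasing order; only the indices
  \<open>1 \<le> i \<le> card \<Omega>\<close> are meaningful.\<close>

definition dirichlet_eigenvalue :: "(int ^ 'n) set \<Rightarrow> nat \<Rightarrow> real" where
  "dirichlet_eigenvalue \<Omega> i = sorted_list_of_multiset (dirichlet_spectrum \<Omega>) ! (i - 1)"

end

theory Submission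
  imports Defs
begin

text \<open>Let \<open>H = -\<Delta>\<^sub>\<Omega>\<close> have the orthonormal eigenbasis \<open>u\<^sub>i\<close>, and let \<open>G\<close> be multiplication by a function.
  Expanding \<open>[H, G] u\<^sub>i\<close> in the eigenbasis, with coefficients
  \<open>\<langle>[H, G] u\<^sub>i, u\<^sub>j\<rangle> = (\<lambda>\<^sub>j - \<lambda>\<^sub>i) \<langle>G u\<^sub>i, u\<^sub>j\<rangle>\<close>, gives
  \<open>\<Sum>\<^sub>i (\<lambda>\<^sub>k\<^sub>+\<^sub>1 - \<lambda>\<^sub>i)\<^sup>2 \<langle>[H, G] u\<^sub>i, G u\<^sub>i\<rangle> \<le> \<Sum>\<^sub>i (\<lambda>\<^sub>k\<^sub>+\<^sub>1 - \<lambda>\<^sub>i) \<parallel>[H, G] u\<^sub>i\<parallel>\<^sup>2\<close>, the sums running over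
  \<open>i \<le> k\<close>. If \<open>G\<close> is a coordinate function, \<open>[H, G]\<close> is a central difference, and both
  sides are controlled by the correlation of \<open>u\<^sub>i\<close> with its translate by a unit vector. Summed over the \<open>n\<close>
  coordinates these correlations give \<open>n (1 - \<lambda>\<^sub>i)\<close>, hence
  \<open>\<langle>[H, G] u\<^sub>i, G u\<^sub>i\<rangle>\<close> adds up to \<open>(1 - \<lambda>\<^sub>i) / 2\<close> and \<open>\<parallel>[H, G] u\<^sub>i\<parallel>\<^sup>2\<close> to at most \<open>2 \<lambda>\<^sub>i / n\<close>.\<close>

section \<open>Symmetric kernels on a finite set\<close>

lemma sum_apply: "(\<Sum>a\<in>A. F a) x = (\<Sum>a\<in>A. F a x :: real)"
  by (induction A rule: infinite_finite_induct) auto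

text \<open>The difference of the two sides is the sum over \<open>i \<le> k\<close> and all \<open>j\<close> of
  \<open>(\<lambda>\<^sub>k\<^sub>+\<^sub>1 - \<lambda>\<^sub>i) (\<lambda>\<^sub>j - \<lambda>\<^sub>i) (\<lambda>\<^sub>k\<^sub>+\<^sub>1 - \<lambda>\<^sub>j) (w i j)\<^sup>2\<close>: the terms with \<open>j \<le> k\<close> cancel by antisymmetry,
  those with \<open>j > k\<close> are nonpositive.\<close>

lemma yang_weights:
  fixes l :: "nat \<Rightarrow> real" and w :: "nat \<Rightarrow> nat \<Rightarrow> real"
  assumes k: "k < N" and mono: "\<And>i j. 1 \<le> i \<Longrightarrow> i \<le> j \<Longrightarrow> j \<le> N \<Longrightarrow> l i \<le> l j"
    and w: "\<And>i j. w i j = w j i"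
  shows "(\<Sum>i=1..k. (l (k + 1) - l i)\<^sup>2 * (\<Sum>j=1..N. (l j - l i) * (w i j)\<^sup>2))
       \<le> (\<Sum>i=1..k. (l (k + 1) - l i) * (\<Sum>j=1..N. ((l j - l i) * w i j)\<^sup>2))"
proof -
  define z where "z = l (k + 1)"
  define F where "F i j = (z - l i) * (l j - l i) * (z - l j) * (w i j)\<^sup>2" for i j
  have "(\<Sum>i=1..k. \<Sum>j=1..k. F i j) = (\<Sum>i=1..k. \<Sum>j=1..k. - F i j)"
    by (subst sum.swap) (auto simp: F_def w intro!: sum.cong, simp add: w algebra_simps)
  then have cancel: "(\<Sum>i=1..k. \<Sum>j=1..k. F i j) = 0" by (simp add: sum_negf)
  have tail: "F i j \<le> 0" if "i \<in> {1..k}" "j \<in> {k+1..N}" for i j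
  proof -
    have "0 \<le> z - l i" "0 \<le> l j - l i" "z - l j \<le> 0"
      using that k mono[of i "k+1"] mono[of i j] mono[of "k+1" j] by (auto simp: z_def)
    then show ?thesis unfolding F_def by (simp add: mult_nonneg_nonpos mult_nonpos_nonneg)
  qed
  have "{1..N} = {1..k} \<union> {k+1..N}" using k by auto
  then have "(\<Sum>j=1..N. F i j) = (\<Sum>j=1..k. F i j) + (\<Sum>j=k+1..N. F i j)" for i
    by (simp only:) (rule sum.union_disjoint, auto)
  then have "(\<Sum>i=1..k. \<Sum>j=1..N. F i j) = (\<Sum>i=1..k. \<Sum>j=k+1..N. F i j)"
    by (simp only: sum.distrib cancel add_0_left)
  also have "\<dots> \<le> 0" using tail by (intro sum_nonpos) auto
  finally have "(\<Sum>i=1..k. \<Sum>j=1..N. F i j) \<le> 0" .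
  \<comment> \<open>The common factor \<open>(z - l i) * (l j - l i)\<close> is left with
    \<open>(z - l i) - (l j - l i) = z - l j\<close>.\<close>
  moreover have "(z - l i)\<^sup>2 * (\<Sum>j=1..N. (l j - l i) * (w i j)\<^sup>2)
      - (z - l i) * (\<Sum>j=1..N. ((l j - l i) * w i j)\<^sup>2) = (\<Sum>j=1..N. F i j)" for i
    unfolding sum_distrib_left sum_subtractf[symmetric] F_def
    by (rule sum.cong) (auto simp: algebra_simps power2_eq_square)
  ultimately have "(\<Sum>i=1..k. (z - l i)\<^sup>2 * (\<Sum>j=1..N. (l j - l i) * (w i j)\<^sup>2)
      - (z - l i) * (\<Sum>j=1..N. ((l j - l i) * w i j)\<^sup>2)) \<le> 0" by (simp only:)
  then show ?thesis unfolding z_def sum_subtractf by simp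
qed

section \<open>Inner product and operator of a symmetric kernel\<close>

locale symmetric_kernel =
  fixes \<Omega> :: "'a set" and K :: "'a \<Rightarrow> 'a \<Rightarrow> real"
  assumes fin: "finite \<Omega>" and sym: "K x y = K y x"
begin

definition supported :: "('a \<Rightarrow> real) set" where
  "supported = {f. \<forall>x. x \<notin> \<Omega> \<longrightarrow> f x = 0}"

text \<open>Vertices carry weight 1: the lattice degree is constant, so leaving it out only rescales
  the inner product and changes neither self-adjointness nor eigenvalues.\<close>

definition ip :: "('a \<Rightarrow> real) \<Rightarrow> ('a \<Rightarrow> real) \<Rightarrow> real" where
  "ip f g = (\<Sum>x\<in>\<Omega>. f x * g x)"

text \<open>The value 0 off \<Omega> allows eigenvector equations to be written as equalities of
  total functions.\<close>

definition kop :: "('a \<Rightarrow> real) \<Rightarrow> 'a \<Rightarrow> real" where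
  "kop f = (\<lambda>x. if x \<in> \<Omega> then \<Sum>y\<in>\<Omega>. K x y * f y else 0)"

lemma kop_supported: "kop f \<in> supported"
  by (simp add: kop_def supported_def)

lemma ip_commute: "ip f g = ip g f"
  by (simp add: ip_def mult.commute)

lemma ip_add_left: "ip (\<lambda>x. f x + g x) h = ip f h + ip g h"
  by (simp add: ip_def algebra_simps sum.distrib)

lemma ip_diff_left: "ip (\<lambda>x. f x - g x) h = ip f h - ip g h"
  by (simp add: ip_def algebra_simps sum_subtractf)

lemma ip_scale_left: "ip (\<lambda>x. c * f x) h = c * ip f h"
  by (simp add: ip_def algebra_simps sum_distrib_left)

lemma ip_add_right: "ip h (\<lambda>x. f x + g x) = ip h f + ip h g"
  by (simp add: ip_def algebra_simps sum.distrib)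

lemma ip_scale_right: "ip h (\<lambda>x. c * f x) = c * ip h f"
  by (simp add: ip_def algebra_simps sum_distrib_left)

lemma ip_sum_left: "ip (\<lambda>x. \<Sum>s\<in>S. f s x) h = (\<Sum>s\<in>S. ip (f s) h)"
  by (simp add: ip_def sum_distrib_right) (rule sum.swap)

lemma ip_self_nonneg: "0 \<le> ip f f"
  by (simp add: ip_def sum_nonneg)

lemma ip_self_eq_0: "f \<in> supported \<Longrightarrow> ip f f = 0 \<longleftrightarrow> f = (\<lambda>x. 0)"
  by (auto simp: ip_def supported_def fin sum_nonneg_eq_0_iff fun_eq_iff)

lemma kop_add: "kop (\<lambda>x. f x + g x) = (\<lambda>x. kop f x + kop g x)"
  by (auto simp: kop_def fun_eq_iff algebra_simps sum.distrib)

lemma kop_scale: "kop (\<lambda>x. c * f x) = (\<lambda>x. c * kop f x)"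
  by (auto simp: kop_def fun_eq_iff algebra_simps sum_distrib_left)

lemma ip_kop: "ip (kop f) g = (\<Sum>x\<in>\<Omega>. \<Sum>y\<in>\<Omega>. K x y * f y * g x)"
  by (simp add: ip_def kop_def sum_distrib_right)

lemma kop_self_adjoint: "ip (kop f) g = ip f (kop g)"
  unfolding ip_kop ip_commute[of f] by (subst sum.swap) (simp add: sym mult_ac)

section \<open>Spectral theorem for symmetric kernels\<close>

text \<open>An orthonormal set of eigenvectors. The eigenvalue of a unit eigenvector is recovered as
  its Rayleigh quotient \<open>ip (kop s) s\<close>.\<close>

definition eigensystem :: "('a \<Rightarrow> real) set \<Rightarrow> bool" where
  "eigensystem S \<longleftrightarrow> S \<subseteq> supported \<and> (\<forall>s\<in>S. \<forall>t\<in>S. ip s t = (if s = t then 1 else 0)) \<and>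
     (\<forall>s\<in>S. kop s = (\<lambda>x. ip (kop s) s * s x))"

text \<open>In the product topology the set is closed, and unit norm together with support in
  \<Omega> puts it inside a product of intervals \<open>{-1..1}\<close> and points
  \<open>{0}\<close>, which is compact by Tychonoff.\<close>

lemma compact_sphere:
  "compact {f \<in> supported. (\<forall>s\<in>S. ip f s = 0) \<and> ip f f = 1}"
proof -
  let ?B = "PiE UNIV (\<lambda>x. if x \<in> \<Omega> then {-1..1::real} else {0})"
  have c: "compact ?B"
    using compactin_PiE[of "\<lambda>_. euclidean" UNIV "\<lambda>x. if x \<in> \<Omega> then {-1..1::real} else {0}"]
    by (auto simp: euclidean_product_topology)
  have cont: "continuous_on UNIV (\<lambda>f. ip f s)" for s
    unfolding ip_def by (intro continuous_intros) auto
  have cont2: "continuous_on UNIV (\<lambda>f. ip f f)"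
    unfolding ip_def by (intro continuous_intros) auto
  have "closed {f. \<forall>s\<in>S. ip f s = 0}"
    unfolding Ball_def by (intro closed_Collect_all closed_Collect_imp closed_Collect_eq cont) auto
  moreover have "closed {f. ip f f = 1}"
    by (intro closed_Collect_eq cont2) auto
  ultimately have "closed ({f. \<forall>s\<in>S. ip f s = 0} \<inter> {f. ip f f = 1})" by (rule closed_Int)
  with c have "compact (?B \<inter> ({f. \<forall>s\<in>S. ip f s = 0} \<inter> {f. ip f f = 1}))" by (rule compact_Int_closed)
  moreover have "\<bar>f x\<bar> \<le> 1" if "ip f f = 1" "x \<in> \<Omega>" for f x
  proof -
    have "f x * f x \<le> ip f f"
      unfolding ip_def by (rule member_le_sum) (use that fin in auto)
    then show ?thesis using that using abs_square_le_1[of "f x"] by (simp add: power2_eq_square)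
  qed
  then have "?B \<inter> ({f. \<forall>s\<in>S. ip f s = 0} \<inter> {f. ip f f = 1}) =
      {f \<in> supported. (\<forall>s\<in>S. ip f s = 0) \<and> ip f f = 1}"
    by (fastforce simp: supported_def PiE_iff abs_le_iff split: if_splits)
  ultimately show ?thesis by simp
qed

text \<open>The eigenvector minimises the Rayleigh quotient on the orthogonal complement of \<open>S\<close>.\<close>

lemma eigenvector_orthogonal:
  assumes S: "eigensystem S" and g: "g \<in> supported" "\<forall>s\<in>S. ip g s = 0" "g \<noteq> (\<lambda>x. 0)"
  obtains u where "u \<in> supported" "\<forall>s\<in>S. ip u s = 0" "ip u u = 1"
    "kop u = (\<lambda>x. ip (kop u) u * u x)"
proof -
  define W where "W = {f \<in> supported. \<forall>s\<in>S. ip f s = 0}"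
  have W_add: "(\<lambda>x. f x + c * h x) \<in> W" if "f \<in> W" "h \<in> W" for f h c
    using that by (auto simp: W_def supported_def ip_add_left ip_scale_left)
  have W_scale: "(\<lambda>x. c * h x) \<in> W" if "h \<in> W" for h c
    using that by (auto simp: W_def supported_def ip_scale_left)
  \<comment> \<open>\<open>W\<close> is invariant because \<open>kop\<close> is self-adjoint and
    maps each element of \<open>S\<close> to a multiple of itself.\<close>
  have W_kop: "kop f \<in> W" if "f \<in> W" for f
  proof -
    have "ip (kop f) s = 0" if "s \<in> S" for s
    proof -
      have "kop s = (\<lambda>x. ip (kop s) s * s x)" using S that by (simp add: eigensystem_def)
      then have "ip (kop s) f = ip (kop s) s * ip s f" by (metis ip_scale_left)
      then have "ip (kop f) s = ip (kop s) s * ip s f"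
        by (simp add: kop_self_adjoint[of f] ip_commute[of f])
      then show ?thesis using \<open>f \<in> W\<close> that by (simp add: W_def ip_commute[of s f])
    qed
    then show ?thesis by (simp add: W_def kop_supported)
  qed
  let ?U = "{f \<in> supported. (\<forall>s\<in>S. ip f s = 0) \<and> ip f f = 1}"
  have normalise: "\<exists>c. c \<noteq> 0 \<and> ip (\<lambda>x. c * f x) (\<lambda>x. c * f x) = 1" if "f \<in> W" "f \<noteq> (\<lambda>x. 0)" for f
  proof -
    have "ip f f > 0" using that ip_self_nonneg[of f] ip_self_eq_0[of f] by (auto simp: W_def less_le)
    moreover have "ip (\<lambda>x. c * f x) (\<lambda>x. c * f x) = c\<^sup>2 * ip f f" for c
      by (simp add: ip_scale_left ip_scale_right power2_eq_square)
    ultimately have "ip (\<lambda>x. (1 / sqrt (ip f f)) * f x) (\<lambda>x. (1 / sqrt (ip f f)) * f x) = 1"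
      "1 / sqrt (ip f f) \<noteq> 0"
      by (simp_all only: power_divide real_sqrt_pow2) simp_all
    then show ?thesis by blast
  qed
  have gW: "g \<in> W" using g by (simp add: W_def)
  obtain c where "ip (\<lambda>x. c * g x) (\<lambda>x. c * g x) = 1" using normalise[OF gW g(3)] by blast
  then have "(\<lambda>x. c * g x) \<in> ?U" using W_scale[OF gW, of c] by (simp add: W_def)
  then have "?U \<noteq> {}" by blast
  moreover have "continuous_on UNIV (\<lambda>f. ip (kop f) f)"
    unfolding ip_kop by (intro continuous_intros) auto
  then have "continuous_on ?U (\<lambda>f. ip (kop f) f)" by (rule continuous_on_subset) simp
  ultimately have "\<exists>u\<in>?U. \<forall>f\<in>?U. ip (kop u) u \<le> ip (kop f) f"
    by (rule continuous_attains_inf[OF compact_sphere])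
  then obtain u where u: "u \<in> ?U" and min: "\<And>f. f \<in> ?U \<Longrightarrow> ip (kop u) u \<le> ip (kop f) f"
    by blast
  define m where "m = ip (kop u) u"
  have uW: "u \<in> W" using u by (simp add: W_def)
  \<comment> \<open>Both sides are homogeneous of degree 2, so minimality on the unit sphere extends
    to all of \<open>W\<close>.\<close>
  have min': "m * ip f f \<le> ip (kop f) f" if "f \<in> W" for f
  proof (cases "f = (\<lambda>x. 0)")
    case True then show ?thesis by (simp add: ip_def)
  next
    case False
    then obtain c where c: "c \<noteq> 0" "ip (\<lambda>x. c * f x) (\<lambda>x. c * f x) = 1" using normalise[OF \<open>f \<in> W\<close> False] by blast
    have "(\<lambda>x. c * f x) \<in> ?U" using c W_scale[OF that, of c] by (simp add: W_def)
    from min[OF this] have "m * ip (\<lambda>x. c * f x) (\<lambda>x. c * f x) \<le> ip (kop (\<lambda>x. c * f x)) (\<lambda>x. c * f x)"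
      using c by (simp add: m_def)
    then have "c\<^sup>2 * (m * ip f f) \<le> c\<^sup>2 * ip (kop f) f"
      by (simp add: kop_scale ip_scale_left ip_scale_right power2_eq_square mult_ac)
    then show ?thesis using c by simp
  qed
  \<comment> \<open>The residual of the eigenvector equation for \<open>u\<close>. It lies in
    \<open>W\<close>, hence is an admissible direction of variation; the first variation
    \<open>p\<close> in this direction equals \<open>ip h h\<close>.\<close>
  define h where "h = (\<lambda>x. kop u x - m * u x)"
  have hW: "h \<in> W" using W_add[OF W_kop[OF uW] uW, of "- m"] by (simp add: h_def)
  define p where "p = ip (kop u) h - m * ip u h"
  define q where "q = ip (kop h) h - m * ip h h"
  have quad: "0 \<le> 2 * t * p + t\<^sup>2 * q" for t
  proof -
    have "ip (kop h) u = ip (kop u) h" by (subst kop_self_adjoint) (rule ip_commute)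
    then have "ip (kop (\<lambda>x. u x + t * h x)) (\<lambda>x. u x + t * h x) = m + 2 * t * ip (kop u) h + t\<^sup>2 * ip (kop h) h"
      by (simp add: kop_add kop_scale ip_add_left ip_scale_left ip_add_right ip_scale_right
            m_def power2_eq_square algebra_simps)
    moreover have "ip (\<lambda>x. u x + t * h x) (\<lambda>x. u x + t * h x) = 1 + 2 * t * ip u h + t\<^sup>2 * ip h h"
      using u by (simp add: ip_add_left ip_scale_left ip_add_right ip_scale_right
            ip_commute[of h u] power2_eq_square algebra_simps)
    ultimately show ?thesis using min'[OF W_add[OF uW hW, of t]]
      by (simp add: p_def q_def algebra_simps)
  qed
  have "p = 0"
  proof (rule ccontr)
    assume "p \<noteq> 0"
    \<comment> \<open>A positive upper bound for \<open>q\<close>, whatever the sign of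
      \<open>q\<close>. Minimising \<open>2 * t * p + t^2 * a\<close> gives the choice of
      \<open>t\<close> and the negative value \<open>- p^2 / a\<close>.\<close>
    define a where "a = \<bar>q\<bar> + 1"
    have a: "0 < a" "q \<le> a" by (auto simp: a_def)
    define t where "t = - p / a"
    have ta: "t * a = - p" using a by (simp add: t_def)
    have "2 * t * p + t\<^sup>2 * q \<le> 2 * t * p + t\<^sup>2 * a"
      using a by (intro add_left_mono mult_left_mono) auto
    also have "\<dots> = t * p" unfolding power2_eq_square mult.assoc ta by simp
    also have "\<dots> = - (p * p) / a" by (simp add: t_def)
    also have "\<dots> < 0"
      using not_real_square_gt_zero[of p] \<open>p \<noteq> 0\<close> a
      by (intro divide_neg_pos) (simp_all only: neg_less_0_iff_less, blast)
    finally show False using quad[of t] by simp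
  qed
  then have "ip h h = 0" unfolding p_def h_def ip_diff_left ip_scale_left by simp
  then have "h = (\<lambda>x. 0)" using hW by (simp add: ip_self_eq_0 W_def)
  then have "kop u = (\<lambda>x. ip (kop u) u * u x)" by (auto simp: h_def m_def fun_eq_iff)
  then show ?thesis using that u by blast
qed

lemma residual_orthogonal:
  assumes "eigensystem S" "finite S" "t \<in> S"
  shows "ip (\<lambda>x. f x - (\<Sum>s\<in>S. ip f s * s x)) t = 0"
proof -
  have "(\<Sum>s\<in>S. ip f s * ip s t) = (\<Sum>s\<in>S. if s = t then ip f s else 0)"
    using assms by (intro sum.cong) (auto simp: eigensystem_def)
  then show ?thesis using assms by (simp add: ip_diff_left ip_sum_left ip_scale_left)
qed

text \<open>The residual of \<open>f\<close> is orthogonal to \<open>S\<close>, so its squared norm,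
  which is nonnegative, is the difference of the two sides.\<close>

lemma bessel:
  assumes "eigensystem S" "finite S"
  shows "(\<Sum>s\<in>S. (ip f s)\<^sup>2) \<le> ip f f"
proof -
  define r where "r = (\<lambda>x. f x - (\<Sum>s\<in>S. ip f s * s x))"
  have "ip r r = ip f r - (\<Sum>s\<in>S. ip f s * ip s r)"
    by (subst (1) r_def) (simp add: ip_diff_left ip_sum_left ip_scale_left)
  also have "(\<Sum>s\<in>S. ip f s * ip s r) = 0"
    using residual_orthogonal[OF assms, of _ f] by (simp add: r_def ip_commute[of _ "\<lambda>x. f x - _ x"])
  also have "ip f r = ip f f - (\<Sum>s\<in>S. (ip f s)\<^sup>2)"
    by (simp add: ip_commute[of f r]) (simp add: r_def ip_diff_left ip_sum_left ip_scale_left power2_eq_square ip_commute)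
  finally show ?thesis using ip_self_nonneg[of r] by simp
qed

lemma ip_delta: "x \<in> \<Omega> \<Longrightarrow> ip (\<lambda>y. if y = x then 1 else 0) f = f x"
  by (simp add: ip_def fin if_distrib[of "\<lambda>c. c * _"] cong: if_cong)

text \<open>The trace of the orthogonal projection onto the span of \<open>S\<close>, computed in
  two ways; it turns pointwise information on the sum of squares into information on
  \<open>card S\<close>.\<close>

lemma sum_norm_eigensystem:
  "eigensystem S \<Longrightarrow> (\<Sum>x\<in>\<Omega>. \<Sum>s\<in>S. (s x)\<^sup>2) = real (card S)"
proof -
  assume S: "eigensystem S"
  have "(\<Sum>x\<in>\<Omega>. \<Sum>s\<in>S. (s x)\<^sup>2) = (\<Sum>s\<in>S. ip s s)"
    by (subst sum.swap) (simp add: ip_def power2_eq_square)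
  also have "\<dots> = real (card S)" using S by (simp add: eigensystem_def)
  finally show ?thesis .
qed

lemma card_eigensystem_le:
  assumes "eigensystem S" "finite S"
  shows "card S \<le> card \<Omega>"
proof -
  have "(\<Sum>s\<in>S. (s x)\<^sup>2) \<le> 1" if "x \<in> \<Omega>" for x
    using bessel[OF assms, of "\<lambda>y. if y = x then 1 else 0"] that by (simp add: ip_delta)
  then have "(\<Sum>x\<in>\<Omega>. \<Sum>s\<in>S. (s x)\<^sup>2) \<le> (\<Sum>x\<in>\<Omega>. 1)" by (rule sum_mono)
  then show ?thesis using sum_norm_eigensystem[OF assms(1)] by simp
qed

text \<open>By Bessel's inequality for point masses an eigensystem has at most \<open>card \<Omega>\<close> elements, so there is
  one of maximal size; it is complete, since otherwise it could be extended.\<close>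

lemma spectral:
  obtains S where "eigensystem S" "finite S" "card S = card \<Omega>"
    "\<And>f x. f \<in> supported \<Longrightarrow> f x = (\<Sum>s\<in>S. ip f s * s x)"
proof -
  define P where "P n \<longleftrightarrow> (\<exists>S. eigensystem S \<and> finite S \<and> card S = n)" for n
  have P0: "P 0" unfolding P_def by (rule exI[of _ "{}"]) (simp add: eigensystem_def)
  have bound: "\<forall>n. P n \<longrightarrow> n \<le> card \<Omega>" using card_eigensystem_le by (auto simp: P_def)
  obtain n where "P n" and n: "\<And>m. P m \<Longrightarrow> m \<le> n"
    using Nat.ex_has_greatest_nat[OF P0 bound] by blast
  then obtain S where S: "eigensystem S" "finite S" "card S = n" by (auto simp: P_def)
  then have max: "card T \<le> card S" if "eigensystem T" "finite T" for T
    using n[of "card T"] that by (auto simp: P_def)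
  note S = S(1,2)
  have complete: "f x = (\<Sum>s\<in>S. ip f s * s x)" if f: "f \<in> supported" for f x
  proof (rule ccontr)
    assume neq: "f x \<noteq> (\<Sum>s\<in>S. ip f s * s x)"
    define r where "r = (\<lambda>x. f x - (\<Sum>s\<in>S. ip f s * s x))"
    have "r \<in> supported" using S f
      by (auto simp: r_def supported_def eigensystem_def intro!: sum.neutral)
    moreover have "\<forall>s\<in>S. ip r s = 0" using residual_orthogonal[OF S] by (simp add: r_def)
    moreover have "r \<noteq> (\<lambda>x. 0)" using neq by (auto simp: r_def fun_eq_iff)
    ultimately obtain u where u: "u \<in> supported" "\<forall>s\<in>S. ip u s = 0" "ip u u = 1"
        "kop u = (\<lambda>x. ip (kop u) u * u x)"
      using eigenvector_orthogonal[OF S(1)] by blast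
    then have "u \<notin> S" by auto
    moreover have "\<forall>s\<in>S. ip s u = 0" using u(2) ip_commute by metis
    then have "eigensystem (insert u S)"
      using u S \<open>u \<notin> S\<close> unfolding eigensystem_def by auto
    ultimately show False using max[of "insert u S"] S by simp
  qed
  \<comment> \<open>Completeness, applied to the point mass at \<open>x\<close>, turns Bessel's
    inequality into an equality at every vertex.\<close>
  have "(\<Sum>s\<in>S. (s x)\<^sup>2) = 1" if "x \<in> \<Omega>" for x
    using complete[of "\<lambda>y. if y = x then 1 else 0" x] that
    by (auto simp: ip_delta power2_eq_square supported_def)
  then have "(\<Sum>x\<in>\<Omega>. \<Sum>s\<in>S. (s x)\<^sup>2) = (\<Sum>x\<in>\<Omega>. 1)" by (rule sum.cong[OF refl])
  then have "card S = card \<Omega>" using sum_norm_eigensystem[OF S(1)] by simp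
  then show ?thesis using that S complete by blast
qed

section \<open>Multiplicities and the sorted spectrum\<close>

lemma independent_eigensystem:
  assumes "eigensystem S"
  shows "real_fun.independent S"
  unfolding real_fun.independent_explicit_module
proof (intro allI impI)
  fix T c v assume T: "finite T" "T \<subseteq> S" and z: "(\<Sum>v\<in>T. (\<lambda>x. c v * v x)) = 0" and v: "v \<in> T"
  have "0 = ip (\<lambda>x. \<Sum>s\<in>T. c s * s x) v"
    using z by (simp add: fun_eq_iff sum_apply ip_def)
  also have "\<dots> = (\<Sum>s\<in>T. if s = v then c s else 0)"
    unfolding ip_sum_left ip_scale_left
    using assms T v by (intro sum.cong) (auto simp: eigensystem_def subset_iff)
  also have "\<dots> = c v" using T v by simp
  finally show "c v = 0" by simp
qed

text \<open>Eigenvectors for different eigenvalues are orthogonal: \<open>ip f (kop s)\<close> can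
  be evaluated with either eigenvalue.\<close>

lemma eigenfunction_coefficient:
  assumes "eigensystem S" "kop f = (\<lambda>x. \<mu> * f x)" "s \<in> S" "ip (kop s) s \<noteq> \<mu>"
  shows "ip f s = 0"
proof -
  have "kop s = (\<lambda>x. ip (kop s) s * s x)" using assms by (simp add: eigensystem_def)
  then have "ip f (kop s) = ip (kop s) s * ip f s" by (metis ip_commute ip_scale_left)
  moreover have "ip f (kop s) = \<mu> * ip f s"
    using assms(2) by (simp add: ip_scale_left flip: kop_self_adjoint)
  ultimately show ?thesis using assms(4) by simp
qed

text \<open>In the expansion of an eigenfunction only the elements of \<open>S\<close> with the same
  eigenvalue survive, so these form a basis of the eigenspace.\<close>

lemma dim_eigenspace:
  assumes S: "eigensystem S" "finite S"
    and complete: "\<And>f x. f \<in> supported \<Longrightarrow> f x = (\<Sum>s\<in>S. ip f s * s x)"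
  shows "real_fun.dim {f \<in> supported. kop f = (\<lambda>x. \<mu> * f x)} = card {s \<in> S. ip (kop s) s = \<mu>}"
proof (rule real_fun.dim_unique)
  let ?B = "{s \<in> S. ip (kop s) s = \<mu>}"
  show "?B \<subseteq> {f \<in> supported. kop f = (\<lambda>x. \<mu> * f x)}"
    using S by (auto simp: eigensystem_def)
  show "real_fun.independent ?B"
    using independent_eigensystem[OF S(1)] by (rule real_fun.independent_mono) auto
  show "{f \<in> supported. kop f = (\<lambda>x. \<mu> * f x)} \<subseteq> real_fun.span ?B"
  proof clarify
    fix f assume f: "f \<in> supported" "kop f = (\<lambda>x. \<mu> * f x)"
    have z: "ip f s = 0" if "s \<in> S - ?B" for s
      using eigenfunction_coefficient[OF S(1) f(2)] that by blast
    have "(\<Sum>s\<in>S. ip f s * s x) = (\<Sum>s\<in>?B. ip f s * s x)" for x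
      by (rule sum.mono_neutral_right) (use S z in auto)
    then have "f = (\<Sum>s\<in>?B. (\<lambda>x. ip f s * s x))"
      unfolding fun_eq_iff sum_apply using complete[OF f(1)] by simp
    moreover have "(\<Sum>s\<in>?B. (\<lambda>x. ip f s * s x)) \<in> real_fun.span ?B"
      by (intro real_fun.span_sum real_fun.span_scale real_fun.span_base) auto
    ultimately show "f \<in> real_fun.span ?B" by simp
  qed
qed simp


definition eigenspace :: "real \<Rightarrow> ('a \<Rightarrow> real) set" where
  "eigenspace \<mu> = {f \<in> supported. kop f = (\<lambda>x. \<mu> * f x)}"

text \<open>Mirrors \<open>dirichlet_spectrum\<close>, so that the two agree once the eigenspaces
  are identified.\<close>

definition spectrum :: "real multiset" where
  "spectrum = (\<Sum>\<mu> | \<exists>f\<in>eigenspace \<mu>. \<exists>x. f x \<noteq> 0. replicate_mset (real_fun.dim (eigenspace \<mu>)) \<mu>)"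

lemma spectrum_eq:
  assumes S: "eigensystem S" "finite S"
    and complete: "\<And>f x. f \<in> supported \<Longrightarrow> f x = (\<Sum>s\<in>S. ip f s * s x)"
  shows "spectrum = image_mset (\<lambda>s. ip (kop s) s) (mset_set S)"
proof (rule multiset_eqI)
  fix \<mu>
  let ?ev = "\<lambda>s. ip (kop s) s"
  \<comment> \<open>A nonzero eigenfunction has a nonzero coefficient, so its eigenvalue occurs in
    \<open>S\<close>. In particular the sum defining \<open>spectrum\<close> has a finite index set
    and does not take its default value.\<close>
  have E: "{\<mu>. \<exists>f\<in>eigenspace \<mu>. \<exists>x. f x \<noteq> 0} = ?ev ` S"
  proof (intro equalityI subsetI; clarify)
    fix \<mu> f x assume f: "f \<in> eigenspace \<mu>" "f x \<noteq> 0"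
    then have "(\<Sum>s\<in>S. ip f s * s x) \<noteq> 0" using complete by (metis (lifting) eigenspace_def mem_Collect_eq)
    then obtain s where "s \<in> S" "ip f s \<noteq> 0" by (metis (no_types, lifting) mult_zero_left sum.neutral)
    then show "\<mu> \<in> ?ev ` S" using eigenfunction_coefficient[OF S(1)] f by (auto simp: eigenspace_def)
  next
    fix s assume s: "s \<in> S"
    then have "ip s s = 1" using S by (simp add: eigensystem_def)
    then have "\<exists>x. s x \<noteq> 0" by (auto simp: ip_def intro: ccontr)
    then show "\<exists>f\<in>eigenspace (?ev s). \<exists>x. f x \<noteq> 0" using s S by (auto simp: eigenspace_def eigensystem_def)
  qed
  have "count spectrum \<mu> = (\<Sum>\<nu>\<in>?ev ` S. if \<nu> = \<mu> then card {s \<in> S. ?ev s = \<nu>} else 0)"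
    unfolding spectrum_def E count_sum by (intro sum.cong) (auto simp: eigenspace_def dim_eigenspace[OF assms])
  also have "\<dots> = card {s \<in> S. ?ev s = \<mu>}" using S by (auto simp: card_eq_0_iff)
  also have "\<dots> = count (image_mset ?ev (mset_set S)) \<mu>"
    using S by (simp add: count_image_mset' conj_commute eq_commute)
  finally show "count spectrum \<mu> = \<dots>" .
qed

text \<open>Orthogonality is implicit: expanding \<open>u j\<close> and pairing with
  \<open>u j\<close> itself forces its coefficients at all other indices to vanish.\<close>

definition eigenbasis :: "(nat \<Rightarrow> 'a \<Rightarrow> real) \<Rightarrow> (nat \<Rightarrow> real) \<Rightarrow> bool" where
  "eigenbasis u l \<longleftrightarrow>
     (\<forall>i\<in>{1..card \<Omega>}. u i \<in> supported \<and> ip (u i) (u i) = 1 \<and> kop (u i) = (\<lambda>x. l i * u i x)) \<and>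
     (\<forall>f\<in>supported. f = (\<lambda>x. \<Sum>i=1..card \<Omega>. ip f (u i) * u i x))"

text \<open>Sorting an eigensystem by eigenvalue gives the sorted list of the spectrum, so the
  \<open>i\<close>-th eigenvector belongs to the \<open>i\<close>-th eigenvalue.\<close>

lemma spectral_sequence:
  obtains u where "eigenbasis u (\<lambda>i. sorted_list_of_multiset spectrum ! (i - 1))"
    "length (sorted_list_of_multiset spectrum) = card \<Omega>"
proof -
  obtain S where S: "eigensystem S" "finite S" "card S = card \<Omega>"
    and complete: "\<And>f x. f \<in> supported \<Longrightarrow> f x = (\<Sum>s\<in>S. ip f s * s x)"
    using spectral by blast
  let ?ev = "\<lambda>s. ip (kop s) s"
  obtain xs where xs: "set xs = S" "distinct xs" using finite_distinct_list S by blast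
  define ys where "ys = sort_key ?ev xs"
  have ys: "set ys = S" "distinct ys" "sorted (map ?ev ys)" by (simp_all add: ys_def xs)
  then have len: "length ys = card \<Omega>" using S distinct_card by metis
  have "mset (map ?ev ys) = spectrum"
    using spectrum_eq[OF S(1,2) complete] ys by (metis mset_map mset_set_set)
  then have sl: "sorted_list_of_multiset spectrum = map ?ev ys"
    using ys(3) by (metis sorted_list_of_multiset_mset sorted_sort_id)
  \<comment> \<open>Eigenvalues are numbered from 1, list positions from 0.\<close>
  define u where "u i = ys ! (i - 1)" for i
  have uS: "u i \<in> S" if "i \<in> {1..card \<Omega>}" for i using that len ys by (auto simp: u_def)
  have "bij_betw ((!) ys) {..<card \<Omega>} S" using ys len by (metis bij_betw_nth)
  moreover have "bij_betw (\<lambda>i. i - 1) {1..card \<Omega>} {..<card \<Omega>}"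
    by (rule bij_betwI[of _ _ _ Suc]) auto
  ultimately have bij: "bij_betw u {1..card \<Omega>} S"
    unfolding u_def using bij_betw_trans[of "\<lambda>i. i - 1" _ _ "(!) ys"] by (simp add: comp_def)
  have "u i \<in> supported \<and> ip (u i) (u i) = 1 \<and>
      kop (u i) = (\<lambda>x. sorted_list_of_multiset spectrum ! (i - 1) * u i x)"
    if i: "i \<in> {1..card \<Omega>}" for i
  proof -
    have "kop (u i) = (\<lambda>x. ?ev (u i) * u i x)" using uS[OF i] S by (auto simp: eigensystem_def)
    moreover have "sorted_list_of_multiset spectrum ! (i - 1) = ?ev (u i)"
      using i len by (auto simp: sl u_def)
    ultimately show ?thesis using uS[OF i] S by (auto simp: eigensystem_def)
  qed
  moreover have "f = (\<lambda>x. \<Sum>i=1..card \<Omega>. ip f (u i) * u i x)" if "f \<in> supported" for f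
    using complete[OF that] sum.reindex_bij_betw[OF bij, of "\<lambda>s. ip f s * s _"] by (simp add: fun_eq_iff)
  ultimately have "eigenbasis u (\<lambda>i. sorted_list_of_multiset spectrum ! (i - 1))"
    unfolding eigenbasis_def by blast
  then show ?thesis by (rule that) (simp add: sl len)
qed

section \<open>Commutators with multiplication operators\<close>

definition commutator :: "('a \<Rightarrow> real) \<Rightarrow> ('a \<Rightarrow> real) \<Rightarrow> 'a \<Rightarrow> real" where
  "commutator g f = (\<lambda>x. kop (\<lambda>x. g x * f x) x - g x * kop f x)"

lemma commutator_inequality:
  fixes l :: "nat \<Rightarrow> real"
  assumes k: "k < card \<Omega>" and mono: "\<And>i j. 1 \<le> i \<Longrightarrow> i \<le> j \<Longrightarrow> j \<le> card \<Omega> \<Longrightarrow> l i \<le> l j"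
    and basis: "eigenbasis u l"
  shows "(\<Sum>i=1..k. (l (k + 1) - l i)\<^sup>2 * ip (commutator g (u i)) (\<lambda>x. g x * u i x))
       \<le> (\<Sum>i=1..k. (l (k + 1) - l i) * ip (commutator g (u i)) (commutator g (u i)))"
proof -
  have eig: "kop (u i) = (\<lambda>x. l i * u i x)" and supp: "u i \<in> supported"
    if "i \<in> {1..card \<Omega>}" for i
    using basis that unfolding eigenbasis_def by blast+
  define w where "w i j = ip (\<lambda>x. g x * u i x) (u j)" for i j
  \<comment> \<open>Multiplication by \<open>g\<close> is self-adjoint; this is the symmetry on
    which the cancellation in \<open>yang_weights\<close> rests.\<close>
  have w: "w i j = w j i" for i j by (auto simp: w_def ip_def mult_ac intro: sum.cong)
  have parseval: "ip f h = (\<Sum>j=1..card \<Omega>. ip f (u j) * ip h (u j))" if "f \<in> supported" for f h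
  proof -
    have "ip f h = ip (\<lambda>x. \<Sum>j=1..card \<Omega>. ip f (u j) * u j x) h"
      using basis that unfolding eigenbasis_def by (metis (no_types, lifting))
    then show ?thesis by (simp add: ip_sum_left ip_scale_left ip_commute[of h])
  qed
  have comm: "commutator g (u i) \<in> supported" if "i \<in> {1..card \<Omega>}" for i
    using supp[OF that] by (auto simp: commutator_def supported_def kop_def)
  \<comment> \<open>Self-adjointness moves \<open>kop\<close> onto \<open>u j\<close> and produces
    \<open>l j\<close>; the other term of the commutator produces \<open>l i\<close>.\<close>
  have coeff: "ip (commutator g (u i)) (u j) = (l j - l i) * w i j"
    if "i \<in> {1..card \<Omega>}" "j \<in> {1..card \<Omega>}" for i j
  proof -
    have "ip (commutator g (u i)) (u j)
        = ip (\<lambda>x. g x * u i x) (kop (u j)) - ip (\<lambda>x. g x * kop (u i) x) (u j)"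
      by (simp add: commutator_def ip_diff_left kop_self_adjoint)
    also have "ip (\<lambda>x. g x * u i x) (kop (u j)) = l j * w i j"
      using that by (simp add: eig w_def ip_commute[of _ "\<lambda>x. l j * u j x"] ip_scale_left ip_commute[of "u j"])
    also have "ip (\<lambda>x. g x * kop (u i) x) (u j) = l i * w i j"
      using that by (simp add: eig w_def mult.left_commute[of "g _"] ip_scale_left)
    finally show ?thesis by (simp add: algebra_simps)
  qed
  have L: "ip (commutator g (u i)) (\<lambda>x. g x * u i x) = (\<Sum>j=1..card \<Omega>. (l j - l i) * (w i j)\<^sup>2)"
    if "i \<in> {1..card \<Omega>}" for i
    using that by (subst parseval[OF comm[OF that]])
      (auto simp: coeff power2_eq_square simp flip: w_def intro!: sum.cong)
  have R: "ip (commutator g (u i)) (commutator g (u i)) = (\<Sum>j=1..card \<Omega>. ((l j - l i) * w i j)\<^sup>2)"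
    if "i \<in> {1..card \<Omega>}" for i
    using that by (subst parseval[OF comm[OF that]])
      (auto simp: coeff power2_eq_square intro!: sum.cong)
  have "(\<Sum>i=1..k. (l (k + 1) - l i)\<^sup>2 * ip (commutator g (u i)) (\<lambda>x. g x * u i x))
      = (\<Sum>i=1..k. (l (k + 1) - l i)\<^sup>2 * (\<Sum>j=1..card \<Omega>. (l j - l i) * (w i j)\<^sup>2))"
    by (rule sum.cong[OF refl], subst L) (use k in auto)
  also have "\<dots> \<le> (\<Sum>i=1..k. (l (k + 1) - l i) * (\<Sum>j=1..card \<Omega>. ((l j - l i) * w i j)\<^sup>2))"
    by (rule yang_weights[OF k mono w])
  also have "\<dots> = (\<Sum>i=1..k. (l (k + 1) - l i) * ip (commutator g (u i)) (commutator g (u i)))"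
    by (rule sum.cong[OF refl], subst R) (use k in auto)
  finally show ?thesis .
qed

end

section \<open>The Dirichlet Laplacian on the integer lattice\<close>

text \<open>The matrix of the negative Laplacian on the whole lattice, symmetric since the degree is
  constant. Summing over \<Omega> only, as \<open>kop\<close> does, imposes the Dirichlet
  condition.\<close>

definition dirichlet_kernel :: "int ^ 'n \<Rightarrow> int ^ 'n \<Rightarrow> real" where
  "dirichlet_kernel x y = (if x = y then 1 else 0)
     - (if y \<in> lattice_neighbours x then 1 / real (lattice_degree x) else 0)"

lemma symmetric_kernel_dirichlet: "finite \<Omega> \<Longrightarrow> symmetric_kernel \<Omega> dirichlet_kernel"
  by unfold_locales
    (auto simp: dirichlet_kernel_def lattice_degree_eq lattice_neighbours_def abs_minus_commute)

lemma sum_lattice_neighbours: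
  fixes x :: "int ^ 'n" and f :: "int ^ 'n \<Rightarrow> real"
  shows "(\<Sum>y\<in>lattice_neighbours x. f y) = (\<Sum>i\<in>UNIV. f (x + axis i 1) + f (x - axis i 1))"
proof -
  have "axis i (-1) = - axis i (1 :: int)" for i :: 'n by (simp add: axis_def vec_eq_iff)
  moreover have "inj_on (\<lambda>(i, s). x + axis i s) (UNIV \<times> {1, -1})"
    by (auto simp: inj_on_def axis_eq_axis)
  ultimately show ?thesis
    unfolding lattice_neighbours_eq
    by (subst sum.reindex) (auto simp: comp_def case_prod_beta sum.cartesian_product' simp flip: diff_conv_add_uminus)
qed

text \<open>The assumptions say that \<open>f x\<close> vanishes unless both \<open>x\<close> and
  \<open>x - e\<close> lie in \<Omega>, as for a product of a supported function and its translate;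
  the translation then leaves no boundary terms.\<close>

lemma sum_shift:
  fixes f :: "'a::ab_group_add \<Rightarrow> real"
  assumes "finite \<Omega>" "\<And>x. x \<notin> \<Omega> \<Longrightarrow> f x = 0" "\<And>x. x - e \<notin> \<Omega> \<Longrightarrow> f x = 0"
  shows "(\<Sum>x\<in>\<Omega>. f x) = (\<Sum>x\<in>\<Omega>. f (x + e))"
proof -
  have "(\<Sum>x\<in>\<Omega>. f (x + e)) = (\<Sum>x\<in>(\<lambda>x. x + e) ` \<Omega>. f x)"
    by (simp add: sum.reindex inj_on_def)
  also have "\<dots> = (\<Sum>x\<in>\<Omega> \<inter> (\<lambda>x. x + e) ` \<Omega>. f x)"
    using assms by (intro sum.mono_neutral_right) auto
  also have "\<dots> = (\<Sum>x\<in>\<Omega>. f x)"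
  proof (rule sum.mono_neutral_left)
    show "\<forall>x\<in>\<Omega> - \<Omega> \<inter> (\<lambda>x. x + e) ` \<Omega>. f x = 0"
    proof
      fix x assume x: "x \<in> \<Omega> - \<Omega> \<inter> (\<lambda>x. x + e) ` \<Omega>"
      then have "x - e \<notin> \<Omega>" by (metis Diff_iff IntI diff_add_cancel image_eqI)
      then show "f x = 0" by (rule assms(3))
    qed
  qed (use assms in auto)
  finally show ?thesis ..
qed

text \<open>Translation can only push mass out of \<Omega>, and this mass is nonnegative.\<close>

lemma sum_shift_le:
  fixes f :: "'a::ab_group_add \<Rightarrow> real"
  assumes "finite \<Omega>" "\<And>x. x \<notin> \<Omega> \<Longrightarrow> f x = 0" "\<And>x. 0 \<le> f x"
  shows "(\<Sum>x\<in>\<Omega>. f (x + e)) \<le> (\<Sum>x\<in>\<Omega>. f x)"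
proof -
  have "(\<Sum>x\<in>\<Omega>. f (x + e)) = (\<Sum>x\<in>(\<lambda>x. x + e) ` \<Omega>. f x)"
    by (simp add: sum.reindex inj_on_def)
  also have "\<dots> = (\<Sum>x\<in>\<Omega> \<inter> (\<lambda>x. x + e) ` \<Omega>. f x)"
    using assms by (intro sum.mono_neutral_right) auto
  also have "\<dots> \<le> (\<Sum>x\<in>\<Omega>. f x)" using assms by (intro sum_mono2) auto
  finally show ?thesis .
qed

locale lattice_domain =
  fixes \<Omega> :: "(int ^ 'n) set"
  assumes finite_domain: "finite \<Omega>"
begin

sublocale symmetric_kernel \<Omega> dirichlet_kernel
  using finite_domain by (rule symmetric_kernel_dirichlet)

abbreviation "step \<equiv> (\<lambda>i. axis i 1 :: int ^ 'n)"

lemma functions_on_eq: "functions_on \<Omega> = supported"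
  by (simp add: functions_on_def supported_def)

section \<open>Identification with the Dirichlet eigenvalues\<close>

lemma kop_neighbours:
  assumes "f \<in> supported" "x \<in> \<Omega>"
  shows "kop f x = f x - 1 / real (2 * CARD('n)) * (\<Sum>y\<in>lattice_neighbours x. f y)"
proof -
  have "kop f x = (\<Sum>y\<in>\<Omega>. (if x = y then f y else 0)
      - 1 / real (2 * CARD('n)) * (if y \<in> lattice_neighbours x then f y else 0))"
    using assms by (auto simp: kop_def dirichlet_kernel_def lattice_degree_eq algebra_simps intro!: sum.cong)
  also have "\<dots> = f x - 1 / real (2 * CARD('n)) * (\<Sum>y\<in>\<Omega>. if y \<in> lattice_neighbours x then f y else 0)"
    using assms finite_domain by (simp add: sum_subtractf sum_distrib_left)
  also have "(\<Sum>y\<in>\<Omega>. if y \<in> lattice_neighbours x then f y else 0) = (\<Sum>y\<in>\<Omega> \<inter> lattice_neighbours x. f y)"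
    using finite_domain by (simp add: sum.inter_restrict)
  also have "\<dots> = (\<Sum>y\<in>lattice_neighbours x. f y)"
    using assms finite_lattice_neighbours by (intro sum.mono_neutral_left) (auto simp: supported_def)
  finally show ?thesis .
qed

lemma kop_eq_dirichlet_laplacian:
  assumes "f \<in> supported"
  shows "kop f = (\<lambda>x. - dirichlet_laplacian \<Omega> f x)"
proof
  fix x
  have "zero_extension \<Omega> f = f" using assms by (auto simp: zero_extension_def supported_def)
  then show "kop f x = - dirichlet_laplacian \<Omega> f x"
  proof (cases "x \<in> \<Omega>")
    case True
    then show ?thesis using \<open>zero_extension \<Omega> f = f\<close>
      by (simp add: dirichlet_laplacian_def laplacian_def lattice_degree_eq kop_neighbours[OF assms])
  qed (simp add: kop_def dirichlet_laplacian_def)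
qed

text \<open>The two conditions differ only off \<Omega>, where both sides of the eigenvalue equation
  vanish.\<close>

lemma dirichlet_eigenspace_eq: "dirichlet_eigenspace \<Omega> \<mu> = eigenspace \<mu>"
proof -
  have "(\<forall>x\<in>\<Omega>. - dirichlet_laplacian \<Omega> f x = \<mu> * f x) \<longleftrightarrow> kop f = (\<lambda>x. \<mu> * f x)"
    if "f \<in> supported" for f
    using that unfolding kop_eq_dirichlet_laplacian[OF that] fun_eq_iff
    by (metis (mono_tags, lifting) dirichlet_laplacian_def mem_Collect_eq minus_zero mult_zero_right supported_def)
  then show ?thesis by (auto simp: dirichlet_eigenspace_def eigenspace_def functions_on_eq)
qed

lemma dirichlet_eigenvalue_eq: "dirichlet_eigenvalue \<Omega> i = sorted_list_of_multiset spectrum ! (i - 1)"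
  by (simp add: dirichlet_eigenvalue_def dirichlet_spectrum_def spectrum_def
      is_dirichlet_eigenvalue_def dirichlet_eigenspace_eq)

section \<open>Coordinate functions and translates\<close>

definition correlation :: "'n \<Rightarrow> (int ^ 'n \<Rightarrow> real) \<Rightarrow> real" where
  "correlation i f = (\<Sum>x\<in>\<Omega>. f x * f (x + step i))"

lemma correlation_backward:
  assumes "f \<in> supported"
  shows "(\<Sum>x\<in>\<Omega>. f x * f (x - step i)) = correlation i f"
  using sum_shift[OF finite_domain, of "\<lambda>x. f x * f (x - step i)" "step i"] assms
  by (simp add: correlation_def supported_def mult.commute)

text \<open>Forward and backward neighbours contribute the same correlation, so the factor
  \<open>1 / (2n)\<close> becomes \<open>1 / n\<close>.\<close>

lemma ip_kop_self:
  assumes "f \<in> supported"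
  shows "ip (kop f) f = ip f f - (\<Sum>i\<in>UNIV. correlation i f) / real CARD('n)"
proof -
  have "ip (kop f) f = (\<Sum>x\<in>\<Omega>. f x * f x - 1 / real (2 * CARD('n)) *
      (\<Sum>i\<in>UNIV. f x * f (x + step i) + f x * f (x - step i)))"
    unfolding ip_def using assms
    by (intro sum.cong) (auto simp: kop_neighbours sum_lattice_neighbours algebra_simps sum_distrib_left sum_distrib_right)
  also have "\<dots> = ip f f - 1 / real (2 * CARD('n)) *
      (\<Sum>i\<in>UNIV. (\<Sum>x\<in>\<Omega>. f x * f (x + step i)) + (\<Sum>x\<in>\<Omega>. f x * f (x - step i)))"
    unfolding sum_subtractf sum_distrib_left[symmetric] sum.distrib[symmetric]
    by (subst sum.swap) (simp add: ip_def)
  also have "\<dots> = ip f f - (\<Sum>i\<in>UNIV. correlation i f) / real CARD('n)"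
    using assms by (simp add: correlation_backward correlation_def[symmetric] sum_distrib_left[symmetric] field_simps)
  finally show ?thesis .
qed

lemma commutator_coordinate:
  assumes f: "f \<in> supported" and x: "x \<in> \<Omega>"
  shows "commutator (\<lambda>x. real_of_int (x $ i)) f x
    = - (f (x + step i) - f (x - step i)) / real (2 * CARD('n))"
proof -
  let ?g = "\<lambda>x. real_of_int (x $ i) * f x"
  have g: "?g \<in> supported" using f by (simp add: supported_def)
  \<comment> \<open>The \<open>i\<close>-th coordinate changes only along direction
    \<open>i\<close>, by 1 with the sign of the step; all other directions cancel.\<close>
  have "(\<Sum>j\<in>UNIV. ?g (x + step j) + ?g (x - step j)) - x $ i * (\<Sum>j\<in>UNIV. f (x + step j) + f (x - step j))
      = (\<Sum>j\<in>UNIV. if j = i then f (x + step i) - f (x - step i) else 0)"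
    unfolding sum_distrib_left sum_subtractf[symmetric]
    by (intro sum.cong) (auto simp: axis_def algebra_simps)
  then have *: "(\<Sum>j\<in>UNIV. ?g (x + step j) + ?g (x - step j)) =
      x $ i * (\<Sum>j\<in>UNIV. f (x + step j) + f (x - step j)) + (f (x + step i) - f (x - step i))"
    by simp
  show ?thesis
    unfolding commutator_def kop_neighbours[OF f x] kop_neighbours[OF g x] sum_lattice_neighbours *
    by (simp add: field_simps)
qed

lemma ip_commutator_coordinate:
  assumes f: "f \<in> supported"
  shows "ip (commutator (\<lambda>x. real_of_int (x $ i)) f) (\<lambda>x. real_of_int (x $ i) * f x)
    = correlation i f / real (2 * CARD('n))"
proof -
  define c where "c = 1 / real (2 * CARD('n))"
  \<comment> \<open>Translation by \<open>step i\<close> raises the coordinate by 1. This extra 1 is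
    what remains when the forward term is subtracted from the backward one.\<close>
  have "(\<Sum>x\<in>\<Omega>. real_of_int (x $ i) * (f x * f (x - step i)))
      = (\<Sum>x\<in>\<Omega>. (real_of_int (x $ i) + 1) * (f (x + step i) * f x))"
    using sum_shift[OF finite_domain, of "\<lambda>x. real_of_int (x $ i) * (f x * f (x - step i))" "step i"] f
    by (auto simp: supported_def axis_def)
  also have "\<dots> = (\<Sum>x\<in>\<Omega>. real_of_int (x $ i) * (f x * f (x + step i))) + correlation i f"
    by (simp add: correlation_def sum.distrib[symmetric] algebra_simps)
  finally have shift: "(\<Sum>x\<in>\<Omega>. real_of_int (x $ i) * (f x * f (x - step i))) = \<dots>" .
  have "ip (commutator (\<lambda>x. real_of_int (x $ i)) f) (\<lambda>x. real_of_int (x $ i) * f x)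
      = (\<Sum>x\<in>\<Omega>. c * (real_of_int (x $ i) * (f x * f (x - step i)) - real_of_int (x $ i) * (f x * f (x + step i))))"
    unfolding ip_def
    by (intro sum.cong) (auto simp: commutator_coordinate[OF f] c_def field_simps)
  also have "\<dots> = c * correlation i f"
    by (simp add: sum_distrib_left[symmetric] sum_subtractf shift)
  finally show ?thesis by (simp add: c_def)
qed

lemma norm_commutator_coordinate:
  assumes f: "f \<in> supported"
  shows "ip (commutator (\<lambda>x. real_of_int (x $ i)) f) (commutator (\<lambda>x. real_of_int (x $ i)) f)
    \<le> 2 * (ip f f - correlation i f) / (real CARD('n))\<^sup>2"
proof -
  define c where "c = 1 / (4 * (real CARD('n))\<^sup>2)"
  have c: "0 \<le> c" by (simp add: c_def)
  \<comment> \<open>The right side is \<open>2 * (a - d)^2 + 2 * (d - b)^2\<close>. It is used with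
    \<open>d = f x\<close> between the two neighbouring values, so that correlations at distance 1
    replace the product \<open>a * b\<close> at distance 2.\<close>
  have pw: "(a - b)\<^sup>2 \<le> 2 * a\<^sup>2 + 4 * (d * d) + 2 * b\<^sup>2 - 4 * (d * a) - 4 * (d * b)" for a b d :: real
  proof -
    have "2 * a\<^sup>2 + 4 * (d * d) + 2 * b\<^sup>2 - 4 * (d * a) - 4 * (d * b) - (a - b)\<^sup>2 = (a + b - 2 * d)\<^sup>2"
      by (simp add: power2_eq_square algebra_simps)
    then show ?thesis by (metis diff_ge_0_iff_ge zero_le_power2)
  qed
  have le: "(\<Sum>x\<in>\<Omega>. (f (x + e))\<^sup>2) \<le> ip f f" for e
    using sum_shift_le[OF finite_domain, of "\<lambda>x. (f x)\<^sup>2" e] f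
    by (simp add: supported_def ip_def power2_eq_square)
  have "ip (commutator (\<lambda>x. real_of_int (x $ i)) f) (commutator (\<lambda>x. real_of_int (x $ i)) f)
      = (\<Sum>x\<in>\<Omega>. c * (f (x + step i) - f (x - step i))\<^sup>2)"
    unfolding ip_def
    by (intro sum.cong) (auto simp: commutator_coordinate[OF f] c_def power2_eq_square field_simps)
  also have "\<dots> \<le> (\<Sum>x\<in>\<Omega>. c * (2 * (f (x + step i))\<^sup>2 + 4 * (f x * f x) + 2 * (f (x - step i))\<^sup>2
      - 4 * (f x * f (x + step i)) - 4 * (f x * f (x - step i))))"
    by (intro sum_mono mult_left_mono pw c)
  also have "\<dots> = c * (2 * (\<Sum>x\<in>\<Omega>. (f (x + step i))\<^sup>2) + 4 * ip f f + 2 * (\<Sum>x\<in>\<Omega>. (f (x + - step i))\<^sup>2)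
      - 4 * correlation i f - 4 * correlation i f)"
    unfolding sum_distrib_left[symmetric] sum_subtractf sum.distrib correlation_backward[OF f]
    by (simp add: ip_def correlation_def)
  \<comment> \<open>The squares have total weight 2 + 4 + 2 = 8, and the translated ones are bounded
    by \<open>ip f f\<close>.\<close>
  also have "\<dots> \<le> c * (8 * (ip f f - correlation i f))"
    using le[of "step i"] le[of "- step i"] by (intro mult_left_mono c) simp
  also have "\<dots> = 2 * (ip f f - correlation i f) / (real CARD('n))\<^sup>2"
    by (simp add: c_def field_simps)
  finally show ?thesis .
qed

section \<open>Summation over the coordinate directions\<close>

lemma yang_inequality:
  assumes "1 \<le> k" "k < card \<Omega>"
  shows "(\<Sum>i=1..k. (dirichlet_eigenvalue \<Omega> (k + 1) - dirichlet_eigenvalue \<Omega> i)\<^sup>2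
             * (1 - dirichlet_eigenvalue \<Omega> i))
           \<le> 4 / real CARD('n) *
             (\<Sum>i=1..k. (dirichlet_eigenvalue \<Omega> (k + 1) - dirichlet_eigenvalue \<Omega> i)
                * dirichlet_eigenvalue \<Omega> i)"
proof -
  define l where "l = dirichlet_eigenvalue \<Omega>"
  define n where "n = real CARD('n)"
  have n: "n > 0" by (simp add: n_def)
  obtain u where basis: "eigenbasis u l"
    and len: "length (sorted_list_of_multiset spectrum) = card \<Omega>"
    using spectral_sequence unfolding l_def dirichlet_eigenvalue_eq[abs_def] by blast
  have supp: "u i \<in> supported" and norm: "ip (u i) (u i) = 1" and eig: "kop (u i) = (\<lambda>x. l i * u i x)"
    if "i \<in> {1..card \<Omega>}" for i
    using basis that unfolding eigenbasis_def by blast+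
  have mono: "l i \<le> l j" if "1 \<le> i" "i \<le> j" "j \<le> card \<Omega>" for i j
    using that len unfolding l_def dirichlet_eigenvalue_eq
    by (intro sorted_nth_mono) (auto simp: sorted_sorted_list_of_multiset)
  let ?X = "\<lambda>\<alpha> x. real_of_int (x $ \<alpha>)"
  have corr: "(\<Sum>\<alpha>\<in>UNIV. correlation \<alpha> (u i)) = n * (1 - l i)" if "i \<in> {1..k}" for i
  proof -
    have i: "i \<in> {1..card \<Omega>}" using that assms by auto
    have "l i = 1 - (\<Sum>\<alpha>\<in>UNIV. correlation \<alpha> (u i)) / n"
      using ip_kop_self[OF supp[OF i]] by (simp add: eig[OF i] ip_scale_left norm[OF i] n_def)
    then show ?thesis using n by (simp add: field_simps)
  qed
  have L: "(\<Sum>\<alpha>\<in>UNIV. ip (commutator (?X \<alpha>) (u i)) (\<lambda>x. ?X \<alpha> x * u i x)) = (1 - l i) / 2"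
    if "i \<in> {1..k}" for i
  proof -
    have i: "i \<in> {1..card \<Omega>}" using that assms by auto
    show ?thesis using n corr[OF that]
      by (simp add: ip_commutator_coordinate[OF supp[OF i]] sum_divide_distrib[symmetric] flip: n_def)
  qed
  have R: "(\<Sum>\<alpha>\<in>UNIV. ip (commutator (?X \<alpha>) (u i)) (commutator (?X \<alpha>) (u i))) \<le> 2 / n * l i"
    if "i \<in> {1..k}" for i
  proof -
    have i: "i \<in> {1..card \<Omega>}" using that assms by auto
    have "(\<Sum>\<alpha>\<in>UNIV. ip (commutator (?X \<alpha>) (u i)) (commutator (?X \<alpha>) (u i)))
        \<le> (\<Sum>\<alpha>\<in>UNIV. 2 * (1 - correlation \<alpha> (u i)) / n\<^sup>2)"
      using norm_commutator_coordinate[OF supp[OF i]] by (intro sum_mono) (simp add: norm[OF i] n_def)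
    also have "\<dots> = 2 * (n - (\<Sum>\<alpha>\<in>UNIV. correlation \<alpha> (u i))) / n\<^sup>2"
      by (simp add: sum_divide_distrib[symmetric] sum_distrib_left[symmetric] sum_subtractf n_def)
    also have "\<dots> = 2 / n * l i"
      using n by (simp add: corr[OF that] power2_eq_square field_simps)
    finally show ?thesis .
  qed
  have "(\<Sum>i=1..k. (l (k + 1) - l i)\<^sup>2 * ((1 - l i) / 2))
      = (\<Sum>\<alpha>\<in>UNIV. \<Sum>i=1..k. (l (k + 1) - l i)\<^sup>2 * ip (commutator (?X \<alpha>) (u i)) (\<lambda>x. ?X \<alpha> x * u i x))"
    by (subst sum.swap) (intro sum.cong, auto simp: sum_distrib_left[symmetric] L)
  also have "\<dots> \<le> (\<Sum>\<alpha>\<in>UNIV. \<Sum>i=1..k. (l (k + 1) - l i) * ip (commutator (?X \<alpha>) (u i)) (commutator (?X \<alpha>) (u i)))"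
    by (intro sum_mono commutator_inequality[OF assms(2) mono basis])
  also have "\<dots> = (\<Sum>i=1..k. (l (k + 1) - l i) *
      (\<Sum>\<alpha>\<in>UNIV. ip (commutator (?X \<alpha>) (u i)) (commutator (?X \<alpha>) (u i))))"
    by (subst sum.swap) (simp add: sum_distrib_left)
  \<comment> \<open>The bound \<open>R\<close> may be inserted because monotonicity makes the
    weights \<open>l (k + 1) - l i\<close> nonnegative.\<close>
  also have "\<dots> \<le> (\<Sum>i=1..k. (l (k + 1) - l i) * (2 / n * l i))"
    using assms mono by (intro sum_mono mult_left_mono R) auto
  finally have "(\<Sum>i=1..k. (l (k + 1) - l i)\<^sup>2 * (1 - l i)) / 2
      \<le> 2 / n * (\<Sum>i=1..k. (l (k + 1) - l i) * l i)"
    by (simp add: sum_divide_distrib sum_distrib_left mult_ac)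
  then show ?thesis by (simp add: l_def n_def)
qed

end

theorem theorem1p4:
  fixes \<Omega> :: "(int ^ 'n) set" and k :: nat
  assumes "finite \<Omega>" and "1 \<le> k" and "k \<le> card \<Omega> - 1"
  shows "(\<Sum>i = 1..k. (dirichlet_eigenvalue \<Omega> (k + 1) - dirichlet_eigenvalue \<Omega> i)\<^sup>2
             * (1 - dirichlet_eigenvalue \<Omega> i))
           \<le> 4 / real CARD('n) *
             (\<Sum>i = 1..k. (dirichlet_eigenvalue \<Omega> (k + 1) - dirichlet_eigenvalue \<Omega> i)
                * dirichlet_eigenvalue \<Omega> i)"
proof -
  interpret lattice_domain \<Omega> by unfold_locales (rule assms(1))
  \<comment> \<open>Since \<open>1 \<le> k\<close>, the truncated subtraction in
    \<open>k \<le> card \<Omega> - 1\<close> does give \<open>k < card \<Omega>\<close>.\<close>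
  show ?thesis using assms by (intro yang_inequality) auto
qed

end
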